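(* Let $x_0\in\mathbb{N}$, with associated orbit $(x_n)_{n\ge0}$ and word $w$. For all $a,b,m\in\mathbb{N}$, the length-$m$ factors of $w$ at $a$ and at $b$ agree (that is, $w_{a+i}=w_{b+i}$ for all $0\le i<m$) if and only if $2^m\mid x_b-x_a$ in $\mathbb{Z}$.
   Context: Here $\mathbb{N}=\{0,1,2,\dots\}$. For $x_0\in\mathbb{N}$ the orbit is defined by $x_{n+1}=\lceil 3x_n/2\rceil$ for $n\ge0$, and the word $w=(w_n)_{n\ge0}$ by $w_n=x_n\bmod 2\in\{0,1\}$; equivalently $w_n=2x_{n+1}-3x_n$. *)

theory Defs
  imports Complex_Main
begin

primrec orbit :: "nat \<Rightarrow> nat \<Rightarrow> nat" where
  "orbit x0 0 = x0"
| "orbit x0 (Suc n) = nat \<lceil>3 * real (orbit x0 n) / 2\<rceil>"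

definition word :: "nat \<Rightarrow> nat \<Rightarrow> nat" where
  "word x0 n = orbit x0 n mod 2"

end

theory Submission
  imports Defs
begin

text \<open>Write d and d' for the differences of the orbit at (a, b) and at (a+1, b+1). If the
  letters at a and b agree, they cancel in the recurrence \<open>two_orbit_Suc\<close>, leaving 3d =
  2d'. As 3 is invertible modulo powers of 2, each further agreeing letter accounts for exactly one
  more factor 2 of d (\<open>power_Suc_dvd_orbit_diff_iff\<close>); induction on m
  concludes.\<close>

text \<open>Since 3x and x have the same parity, adding that parity to 3x rounds it up to an even
  number, so the ceiling becomes an exact linear recurrence.\<close>

lemma two_orbit_Suc: "2 * orbit x0 (Suc n) = 3 * orbit x0 n + word x0 n"
proof -
  have "\<lceil>3 * real (orbit x0 n) / 2\<rceil> = int ((3 * orbit x0 n + word x0 n) div 2)"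
    unfolding word_def by (rule ceiling_unique; cases "even (orbit x0 n)") (auto elim!: evenE oddE)
  moreover have "even (3 * orbit x0 n + word x0 n)"
    by (simp add: word_def)
  ultimately show ?thesis
    by simp
qed

lemma word_eq_iff_even_diff:
  "word x0 a = word x0 b \<longleftrightarrow> even (int (orbit x0 b) - int (orbit x0 a))"
  by (simp add: word_def mod2_eq_if)

lemma power_Suc_dvd_orbit_diff_iff:
  assumes "word x0 a = word x0 b"
  shows "(2::int) ^ Suc m dvd int (orbit x0 b) - int (orbit x0 a) \<longleftrightarrow>
    2 ^ m dvd int (orbit x0 (Suc b)) - int (orbit x0 (Suc a))"
proof -
  let ?d = "int (orbit x0 b) - int (orbit x0 a)"
  let ?d' = "int (orbit x0 (Suc b)) - int (orbit x0 (Suc a))"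
  have "3 * ?d = 2 * ?d'"
    using two_orbit_Suc[of x0 a] two_orbit_Suc[of x0 b] assms
    \<comment> \<open>Unfolding \<open>orbit\<close> would bring the ceilings back and hide the
      terms of the recurrence.\<close>
    by (simp del: orbit.simps)
  moreover have "coprime ((2::int) ^ Suc m) 3"
    by (intro coprime_power_left_iff[THEN iffD2]) simp
  ultimately have "2 ^ Suc m dvd ?d \<longleftrightarrow> 2 ^ Suc m dvd 2 * ?d'"
    by (metis coprime_dvd_mult_right_iff)
  then show ?thesis
    by (simp only: power_Suc dvd_times_left_cancel_iff)
qed

theorem theorem4p2:
  fixes x0 a b m :: nat
  shows "(\<forall>i<m. word x0 (a + i) = word x0 (b + i)) \<longleftrightarrow>
    (2::int) ^ m dvd int (orbit x0 b) - int (orbit x0 a)"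
\<comment> \<open>The hypothesis is needed at the shifted positions a+1 and b+1.\<close>
proof (induction m arbitrary: a b)
  case 0
  show ?case by simp
next
  case (Suc m)
  let ?d = "int (orbit x0 b) - int (orbit x0 a)"
  have "(\<forall>i<Suc m. word x0 (a + i) = word x0 (b + i)) \<longleftrightarrow>
      word x0 a = word x0 b \<and> (\<forall>i<m. word x0 (Suc a + i) = word x0 (Suc b + i))"
    by (simp add: All_less_Suc2)
  also have "\<dots> \<longleftrightarrow> word x0 a = word x0 b \<and> 2 ^ Suc m dvd ?d"
    using Suc.IH power_Suc_dvd_orbit_diff_iff by blast
  \<comment> \<open>The exponent is positive, so the divisibility already makes ?d even, which is
    agreement of the first letters.\<close>
  also have "\<dots> \<longleftrightarrow> 2 ^ Suc m dvd ?d"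
    unfolding word_eq_iff_even_diff by (auto dest: dvd_mult_left)
  finally show ?case .
qed

end
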